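(* Let $(M,\mathcal B,\mu,\Phi_t)$ be a system with pure point spectrum and smooth generating Koopman eigenfunctions as described in the context, with vector fields $v_i=\Omega_i\frac{\partial}{\partial\theta^i}$, and let $F:M\to\mathbb R^d$ be a smooth embedding with reconstructed vector fields $V_i=F_*v_i$, $i=1,\dots,m$. Then the $V_i$ transform naturally as type $(1,0)$ tensors. That is, given a smooth map $G:\mathbb R^d\to\mathbb R^{\tilde d}$ such that $\tilde F=G\circ F$ is an embedding of $M$ into $\mathbb R^{\tilde d}$, the reconstructed vector fields $\tilde V_i=\tilde F_*v_i$ in $\mathbb R^{\tilde d}$ are related to the $V_i$ via $\tilde V_i=G_*V_i$.
   Context: Setting. $M$ is a closed, connected, compact, orientable $C^\infty$ manifold of dimension $m$ with Borel $\sigma$-algebra $\mathcal B$; $\Phi_t:M\to M$, $t\in\mathbb R$, is a smooth flow with generating smooth vector field $v$; $\mu$ is a $\Phi_t$-invariant Borel probability measure with smooth positive density in local coordinates, ergodic for the discrete-time system $\Phi_{nT}$, $n\in\mathbb Z$, where $T>0$ is fixed. $\tilde v$ is the skew-adjoint generator of the Koopman group $U_tf=f\circ\Phi_t$ on $L^2(M,\mu)$. Pure point spectrum. There are rationally independent real numbers $\Omega_1,\dots,\Omega_m$ and smooth eigenfunctions $\zeta_i$ with $\tilde v(\zeta_i)=\mathrm i\,\Omega_i\zeta_i$, $|\zeta_i|=1$, such that $z_k=\prod_{i=1}^m\zeta_i^{k_i}$, $k\in\mathbb Z^m$, form an orthonormal basis of $L^2(M,\mu)$. The map $(\zeta_1,\dots,\zeta_m):M\to\mathbb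 T^m$ is a $C^\infty$ diffeomorphism, giving angle coordinates $\theta^i$ with $\zeta_i=e^{\mathrm i\theta^i}$ and globally defined vector fields $\frac{\partial}{\partial\theta^i}$ on $M$. Pushforward. For a smooth map $F:M\to\mathbb R^d$, $F_*:TM\to T\mathbb R^d$ is the derivative map; for a vector field $u$ on $M$, $F_*u$ is viewed as the field of vectors $a\mapsto F_*(u|_a)\in T_{F(a)}\mathbb R^d\simeq\mathbb R^d$ along $F(M)$ (equivalently $F_*u=u(F)$ componentwise). In the eigenfunction basis, $V_i=F_*v_i=\sum_{k}\mathrm i k_i\Omega_i\hat F_kz_k$ $\mu$-a.e., with $\hat F_k=\int_M z_k^*F\,d\mu$. $G_*V_i$ is the field obtained by applying the derivative of $G$ at $F(a)$ to $V_i|_a$. *)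

theory Defs
  imports "HOL-Probability.Probability"
begin

text \<open>In finite dimension, all directional derivatives being \<open>C\<^sup>k\<close> is the same as the
  derivative being \<open>C\<^sup>k\<close>. The set \<open>S\<close> is meant to be open.\<close>

primrec Ck_on ::
    "nat \<Rightarrow> ('e::real_normed_vector \<Rightarrow> 'f::real_normed_vector) \<Rightarrow> 'e set \<Rightarrow> bool" where
  "Ck_on 0 f S \<longleftrightarrow> continuous_on S f"
| "Ck_on (Suc k) f S \<longleftrightarrow>
     (\<forall>x\<in>S. f differentiable (at x)) \<and>
     (\<forall>v. Ck_on k (\<lambda>x. frechet_derivative f (at x) v) S)"

definition smooth_on :: "'e set \<Rightarrow> ('e::real_normed_vector \<Rightarrow> 'f::real_normed_vector) \<Rightarrow> bool"
  where "smooth_on S f \<longleftrightarrow> (\<forall>k. Ck_on k f S)"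

text \<open>A manifold is a subset \<open>M\<close> of a Hausdorff second countable space, with the subspace
  topology, together with an atlas \<open>A\<close>, which need not be maximal. Charts are onto open subsets
  of a Euclidean space, so there is no boundary.\<close>

type_synonym ('a, 'e) chart = "'a set \<times> ('a \<Rightarrow> 'e)"

definition smooth_atlas ::
    "'a::{t2_space,second_countable_topology} set \<Rightarrow> ('a, 'e::euclidean_space) chart set \<Rightarrow> bool"
  where "smooth_atlas M A \<longleftrightarrow>
    (\<forall>(U, \<phi>)\<in>A. openin (top_of_set M) U \<and> open (\<phi> ` U) \<and>
                homeomorphism U (\<phi> ` U) \<phi> (inv_into U \<phi>)) \<and>
    M = (\<Union>(U, \<phi>)\<in>A. U) \<and>
    (\<forall>(U, \<phi>)\<in>A. \<forall>(V, \<psi>)\<in>A. smooth_on (\<phi> ` (U \<inter> V)) (\<psi> \<circ> inv_into U \<phi>))"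

definition orientable ::
    "'a::{t2_space,second_countable_topology} set \<Rightarrow> ('a, real^'m::finite) chart set \<Rightarrow> bool"
  where "orientable M A \<longleftrightarrow>
    (\<exists>B. smooth_atlas M B \<and> smooth_atlas M (A \<union> B) \<and>
      (\<forall>(U, \<phi>)\<in>B. \<forall>(V, \<psi>)\<in>B. \<forall>x\<in>U \<inter> V.
         det (matrix (frechet_derivative (\<psi> \<circ> inv_into U \<phi>) (at (\<phi> x)))) > 0))"

definition smooth_map ::
    "'a::topological_space set \<Rightarrow> ('a, 'e::euclidean_space) chart set \<Rightarrow>
     'b::topological_space set \<Rightarrow> ('b, 'f::euclidean_space) chart set \<Rightarrow> ('a \<Rightarrow> 'b) \<Rightarrow> bool"
  where "smooth_map M A N B f \<longleftrightarrow>
    f ` M \<subseteq> N \<and> continuous_on M f \<and>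
    (\<forall>(U, \<phi>)\<in>A. \<forall>(V, \<psi>)\<in>B. smooth_on (\<phi> ` (U \<inter> f -` V)) (\<psi> \<circ> f \<circ> inv_into U \<phi>))"

definition diffeomorphism ::
    "'a::topological_space set \<Rightarrow> ('a, 'e::euclidean_space) chart set \<Rightarrow>
     'b::topological_space set \<Rightarrow> ('b, 'f::euclidean_space) chart set \<Rightarrow> ('a \<Rightarrow> 'b) \<Rightarrow> bool"
  where "diffeomorphism M A N B f \<longleftrightarrow>
    bij_betw f M N \<and> smooth_map M A N B f \<and> smooth_map N B M A (inv_into M f)"

definition euclid_atlas :: "('e, 'e::euclidean_space) chart set"
  where "euclid_atlas = {(UNIV, id)}"

definition prod_atlas ::
    "('a, 'e) chart set \<Rightarrow> ('b, 'f) chart set \<Rightarrow> ('a \<times> 'b, 'e \<times> 'f) chart set"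
  where "prod_atlas A B = {(U \<times> V, map_prod \<phi> \<psi>) | U \<phi> V \<psi>. (U, \<phi>) \<in> A \<and> (V, \<psi>) \<in> B}"

definition torus :: "(complex^'m::finite) set"
  where "torus = {z. \<forall>i. cmod (z $ i) = 1}"

definition torus_exp :: "real^'m \<Rightarrow> complex^'m::finite"
  where "torus_exp \<theta> = (\<chi> i. cis (\<theta> $ i))"

text \<open>The charts are the local inverses of \<open>torus_exp\<close> on the open cubes with side \<open>2 \<pi>\<close>.\<close>

definition torus_atlas :: "(complex^'m::finite, real^'m) chart set"
  where "torus_atlas =
    (\<lambda>c. let Q = {\<theta>. \<forall>i. \<bar>\<theta> $ i - c $ i\<bar> < pi} in (torus_exp ` Q, inv_into Q torus_exp)) ` UNIV"

definition smooth_functions ::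
    "'a::topological_space set \<Rightarrow> ('a, 'e::euclidean_space) chart set \<Rightarrow> ('a \<Rightarrow> real) set"
  where "smooth_functions M A = {f. smooth_map M A UNIV euclid_atlas f}"

text \<open>Tangent vectors at \<open>a\<close> are the derivations at \<open>a\<close> of the algebra of smooth functions on
  \<open>M\<close>. As functions in HOL are total, derivations are set to 0 outside that algebra; this makes
  equality of tangent vectors the same as equality in HOL.\<close>

type_synonym 'a tvec = "('a \<Rightarrow> real) \<Rightarrow> real"

type_synonym 'a vfield = "'a \<Rightarrow> 'a tvec"

definition tangent_space ::
    "'a::topological_space set \<Rightarrow> ('a, 'e::euclidean_space) chart set \<Rightarrow> 'a \<Rightarrow> 'a tvec set"
  where "tangent_space M A a = {X.
    (\<forall>f\<in>smooth_functions M A. \<forall>g\<in>smooth_functions M A.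
        X (\<lambda>x. f x + g x) = X f + X g \<and>
        X (\<lambda>x. f x * g x) = f a * X g + g a * X f) \<and>
    (\<forall>f\<in>smooth_functions M A. \<forall>c. X (\<lambda>x. c * f x) = c * X f) \<and>
    (\<forall>f. f \<notin> smooth_functions M A \<longrightarrow> X f = 0)}"

definition smooth_vector_field ::
    "'a::topological_space set \<Rightarrow> ('a, 'e::euclidean_space) chart set \<Rightarrow> 'a vfield \<Rightarrow> bool"
  where "smooth_vector_field M A X \<longleftrightarrow>
    (\<forall>a\<in>M. X a \<in> tangent_space M A a) \<and>
    (\<forall>f\<in>smooth_functions M A. (\<lambda>a. X a f) \<in> smooth_functions M A)"

text \<open>The derivative map at a point, from derivations of the source to derivations of
  \<open>\<real>\<^sup>d\<close>, and the canonical identification of the latter with \<open>\<real>\<^sup>d\<close>.\<close>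

definition tangent_map :: "('a \<Rightarrow> real^'d::finite) \<Rightarrow> 'a tvec \<Rightarrow> (real^'d) tvec"
  where "tangent_map F X =
    (\<lambda>h. if h \<in> smooth_functions UNIV euclid_atlas then X (h \<circ> F) else 0)"

definition euclid_tvec :: "(real^'d::finite) tvec \<Rightarrow> real^'d"
  where "euclid_tvec D = (\<chi> j. D (\<lambda>y. y $ j))"

definition pushforward :: "('a \<Rightarrow> real^'d::finite) \<Rightarrow> 'a vfield \<Rightarrow> 'a \<Rightarrow> real^'d"
  where "pushforward F u a = euclid_tvec (tangent_map F (u a))"

text \<open>The image under \<open>G\<close> of a field \<open>V\<close> of vectors in \<open>\<real>\<^sup>d\<close> along \<open>F\<close>, where \<open>V a\<close> is attached
  at the point \<open>F a\<close>.\<close>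

definition pushforward_along ::
    "(real^'d::finite \<Rightarrow> real^'n::finite) \<Rightarrow> ('a \<Rightarrow> real^'d) \<Rightarrow> ('a \<Rightarrow> real^'d) \<Rightarrow> 'a \<Rightarrow> real^'n"
  where "pushforward_along G F V a = frechet_derivative G (at (F a)) (V a)"

definition smooth_embedding ::
    "'a::topological_space set \<Rightarrow> ('a, 'e::euclidean_space) chart set \<Rightarrow> ('a \<Rightarrow> real^'d::finite) \<Rightarrow> bool"
  where "smooth_embedding M A F \<longleftrightarrow>
    smooth_map M A UNIV euclid_atlas F \<and>
    (\<forall>a\<in>M. inj_on (tangent_map F) (tangent_space M A a)) \<and>
    (\<exists>g. homeomorphism M (F ` M) F g)"

definition smooth_flow ::
    "'a::topological_space set \<Rightarrow> ('a, 'e::euclidean_space) chart set \<Rightarrow> (real \<Rightarrow> 'a \<Rightarrow> 'a) \<Rightarrow> bool"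
  where "smooth_flow M A \<Phi> \<longleftrightarrow>
    smooth_map (UNIV \<times> M) (prod_atlas euclid_atlas A) M A (\<lambda>(t, x). \<Phi> t x) \<and>
    (\<forall>x\<in>M. \<Phi> 0 x = x) \<and>
    (\<forall>s t. \<forall>x\<in>M. \<Phi> (s + t) x = \<Phi> s (\<Phi> t x))"

definition generates_flow ::
    "'a::topological_space set \<Rightarrow> ('a, 'e::euclidean_space) chart set \<Rightarrow>
     'a vfield \<Rightarrow> (real \<Rightarrow> 'a \<Rightarrow> 'a) \<Rightarrow> bool"
  where "generates_flow M A v \<Phi> \<longleftrightarrow>
    (\<forall>a\<in>M. \<forall>f\<in>smooth_functions M A. ((\<lambda>t. f (\<Phi> t a)) has_real_derivative v a f) (at 0))"

definition smooth_positive_density ::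
    "('a, real^'m::finite) chart set \<Rightarrow> 'a measure \<Rightarrow> bool"
  where "smooth_positive_density A \<mu> \<longleftrightarrow>
    (\<forall>(U, \<phi>)\<in>A. \<exists>\<rho>. smooth_on (\<phi> ` U) \<rho> \<and> (\<forall>y\<in>\<phi> ` U. \<rho> y > 0) \<and>
       (\<forall>B\<in>sets \<mu>. B \<subseteq> U \<longrightarrow> emeasure \<mu> B = (\<integral>\<^sup>+y\<in>\<phi> ` B. ennreal (\<rho> y) \<partial>lborel)))"

definition measure_preserving :: "'a measure \<Rightarrow> ('a \<Rightarrow> 'a) \<Rightarrow> bool"
  where "measure_preserving \<mu> S \<longleftrightarrow> S \<in> measurable \<mu> \<mu> \<and> distr \<mu> \<mu> S = \<mu>"

definition ergodic :: "'a measure \<Rightarrow> ('a \<Rightarrow> 'a) \<Rightarrow> bool"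
  where "ergodic \<mu> S \<longleftrightarrow>
    (\<forall>B\<in>sets \<mu>. S -` B \<inter> space \<mu> = B \<longrightarrow> measure \<mu> B = 0 \<or> measure \<mu> B = 1)"

definition L2 :: "'a measure \<Rightarrow> ('a \<Rightarrow> complex) set"
  where "L2 \<mu> = {f \<in> borel_measurable \<mu>. integrable \<mu> (\<lambda>x. (cmod (f x))\<^sup>2)}"

definition koopman :: "(real \<Rightarrow> 'a \<Rightarrow> 'a) \<Rightarrow> real \<Rightarrow> ('a \<Rightarrow> complex) \<Rightarrow> 'a \<Rightarrow> complex"
  where "koopman \<Phi> t f = f \<circ> \<Phi> t"

text \<open>The graph of the generator: the strong derivative in \<open>L\<^sup>2\<close> of the Koopman group at time 0.
  Elements of \<open>L\<^sup>2\<close> are given by representatives, so the graph is closed under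
  changes on null sets.\<close>

definition koopman_generator ::
    "'a measure \<Rightarrow> (real \<Rightarrow> 'a \<Rightarrow> 'a) \<Rightarrow> (('a \<Rightarrow> complex) \<times> ('a \<Rightarrow> complex)) set"
  where "koopman_generator \<mu> \<Phi> = {(f, g). f \<in> L2 \<mu> \<and> g \<in> L2 \<mu> \<and>
    ((\<lambda>t. \<integral>x. (cmod ((koopman \<Phi> t f x - f x) / complex_of_real t - g x))\<^sup>2 \<partial>\<mu>) \<longlongrightarrow> 0) (at 0)}"

definition orthonormal_basis_L2 :: "'a measure \<Rightarrow> ('k \<Rightarrow> 'a \<Rightarrow> complex) \<Rightarrow> bool"
  where "orthonormal_basis_L2 \<mu> z \<longleftrightarrow>
    (\<forall>k. z k \<in> L2 \<mu>) \<and>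
    (\<forall>k l. (\<integral>x. cnj (z k x) * z l x \<partial>\<mu>) = (if k = l then 1 else 0)) \<and>
    (\<forall>f\<in>L2 \<mu>. \<forall>\<epsilon>>0. \<exists>K c. finite K \<and>
       (\<integral>x. (cmod (f x - (\<Sum>k\<in>K. c k * z k x)))\<^sup>2 \<partial>\<mu>) < \<epsilon>)"

definition rationally_independent :: "('m::finite \<Rightarrow> real) \<Rightarrow> bool"
  where "rationally_independent \<Omega> \<longleftrightarrow>
    (\<forall>q :: 'm \<Rightarrow> rat. (\<Sum>i\<in>UNIV. of_rat (q i) * \<Omega> i) = 0 \<longrightarrow> (\<forall>i. q i = 0))"

definition eigenfunction_map :: "('m::finite \<Rightarrow> 'a \<Rightarrow> complex) \<Rightarrow> 'a \<Rightarrow> complex^'m"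
  where "eigenfunction_map \<zeta> a = (\<chi> i. \<zeta> i a)"

definition pure_point_system ::
    "'a::topological_space set \<Rightarrow> ('a, real^'m::finite) chart set \<Rightarrow> 'a measure \<Rightarrow>
     (real \<Rightarrow> 'a \<Rightarrow> 'a) \<Rightarrow> ('m \<Rightarrow> real) \<Rightarrow> ('m \<Rightarrow> 'a \<Rightarrow> complex) \<Rightarrow> bool"
  where "pure_point_system M A \<mu> \<Phi> \<Omega> \<zeta> \<longleftrightarrow>
    rationally_independent \<Omega> \<and>
    (\<forall>i. smooth_map M A UNIV euclid_atlas (\<zeta> i)) \<and>
    (\<forall>i. (\<zeta> i, \<lambda>x. \<i> * complex_of_real (\<Omega> i) * \<zeta> i x) \<in> koopman_generator \<mu> \<Phi>) \<and>
    (\<forall>i. \<forall>x\<in>M. cmod (\<zeta> i x) = 1) \<and>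
    orthonormal_basis_L2 \<mu> (\<lambda>(k :: int^'m) x. \<Prod>i\<in>UNIV. \<zeta> i x powi (k $ i)) \<and>
    diffeomorphism M A torus torus_atlas (eigenfunction_map \<zeta>)"

text \<open>The coordinate field of the angle \<open>\<theta>\<^sup>i\<close>, where \<open>\<zeta>\<^sub>i = cis \<theta>\<^sup>i\<close>: it differentiates along
  the curve through \<open>a\<close> on which \<open>\<theta>\<^sup>i\<close> is increased by \<open>s\<close>, that is \<open>\<zeta>\<^sub>i\<close> is multiplied by
  \<open>cis s\<close>, and the other angles are constant. It does not depend on local choices of angles.\<close>

definition angle_field ::
    "'a::topological_space set \<Rightarrow> ('a, real^'m::finite) chart set \<Rightarrow>
     ('m \<Rightarrow> 'a \<Rightarrow> complex) \<Rightarrow> 'm \<Rightarrow> 'a vfield"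
  where "angle_field M A \<zeta> i a f =
    (if f \<in> smooth_functions M A
     then deriv (\<lambda>s. f (inv_into M (eigenfunction_map \<zeta>)
                         (\<chi> j. if j = i then cis s * \<zeta> j a else \<zeta> j a))) 0
     else 0)"

end

(* Along the curve c(s) through a on which the angle theta^i is increased by s, the angle field
   is differentiation at s = 0. Hence V_i(a) is Omega_i times the velocity of F o c at 0, and the
   claim is the chain rule for G o (F o c). What has to be checked is that F o c is
   differentiable at 0: in a torus chart around the image of a and a chart of M around a, the
   curve is a straight line followed by the smooth inverse of the eigenfunction map. *)

theory Submission
  imports Defs
begin

section \<open>Calculus of \<open>Ck_on\<close>\<close>

text \<open>An open set is a neighbourhood of each of its points, so functions that agree on it have
  the same derivatives there. The induction varies \<open>f\<close> and \<open>g\<close> because its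
  hypothesis is applied to their directional derivatives.\<close>

lemma Ck_on_cong:
  assumes "open S" and "\<And>x. x \<in> S \<Longrightarrow> f x = g x" and "Ck_on k f S"
  shows "Ck_on k g S"
  using assms(2,3)
proof (induction k arbitrary: f g)
  case 0
  then show ?case by (simp cong: continuous_on_cong)
next
  case (Suc k)
  have D: "(g has_derivative frechet_derivative f (at x)) (at x)" if "x \<in> S" for x
  proof (rule has_derivative_transform_within_open)
    show "(f has_derivative frechet_derivative f (at x)) (at x)"
      using Suc.prems(2) that frechet_derivative_works by auto
  qed (use Suc.prems that assms(1) in auto)
  have E: "frechet_derivative f (at x) v = frechet_derivative g (at x) v" if "x \<in> S" for x v
    by (simp add: frechet_derivative_at[OF D[OF that], symmetric])
  have "Ck_on k (\<lambda>x. frechet_derivative g (at x) v) S" for v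
    by (rule Suc.IH[OF E]) (use Suc.prems(2) in simp_all)
  with D show ?case
    by (auto simp: differentiable_def)
qed

lemma Ck_on_const: "Ck_on k (\<lambda>x. c) S"
  by (induction k arbitrary: c) (simp_all add: frechet_derivative_const)

lemma Ck_on_bounded_linear:
  assumes "bounded_linear L"
  shows "Ck_on k L S"
proof (cases k)
  case 0
  with assms show ?thesis by (simp add: linear_continuous_on)
next
  case (Suc n)
  have "frechet_derivative L (at x) = L" for x
    using frechet_derivative_at[OF bounded_linear_imp_has_derivative[OF assms]] by simp
  with Suc show ?thesis
    by (simp add: Ck_on_const bounded_linear_imp_differentiable[OF assms])
qed

text \<open>Differentiation commutes with \<open>L\<close>: the directional derivatives of the
  composite are again \<open>L\<close> after those of \<open>f\<close>, so the induction
  closes.\<close>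

lemma Ck_on_bounded_linear_compose:
  assumes "open S" and "bounded_linear L" and "Ck_on k f S"
  shows "Ck_on k (\<lambda>x. L (f x)) S"
  using assms(3)
proof (induction k arbitrary: f)
  case 0
  then show ?case
    using bounded_linear.continuous_on[OF assms(2)] by simp
next
  case (Suc k)
  have D: "((\<lambda>y. L (f y)) has_derivative (\<lambda>v. L (frechet_derivative f (at x) v))) (at x)"
    if "x \<in> S" for x
  proof (rule bounded_linear.has_derivative[OF assms(2)])
    show "(f has_derivative frechet_derivative f (at x)) (at x)"
      using Suc.prems that frechet_derivative_works by auto
  qed
  have E: "L (frechet_derivative f (at x) v) = frechet_derivative (\<lambda>y. L (f y)) (at x) v"
    if "x \<in> S" for x v
    by (simp add: frechet_derivative_at[OF D[OF that], symmetric])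
  have "Ck_on k (\<lambda>x. frechet_derivative (\<lambda>y. L (f y)) (at x) v) S" for v
    by (rule Ck_on_cong[OF assms(1) E Suc.IH]) (use Suc.prems in simp_all)
  with D show ?case
    by (auto simp: differentiable_def)
qed

lemma smooth_on_imp_differentiable:
  assumes "smooth_on S f" and "x \<in> S"
  shows "f differentiable (at x)"
proof -
  have "Ck_on (Suc 0) f S" using assms(1) unfolding smooth_on_def by blast
  with assms(2) show ?thesis by simp
qed

section \<open>Components of a pushforward\<close>

text \<open>\<open>tangent_map\<close> returns 0 off the smooth functions. The coordinate functions
  read by \<open>euclid_tvec\<close> must be known to be smooth before this default can be ruled
  out.\<close>

lemma bounded_linear_smooth_functions:
  assumes "bounded_linear L"
  shows "L \<in> smooth_functions UNIV euclid_atlas"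
  using Ck_on_bounded_linear[OF assms] linear_continuous_on[OF assms]
  by (simp add: smooth_functions_def smooth_map_def euclid_atlas_def smooth_on_def comp_def)

text \<open>This makes the components of a smooth map admissible arguments of
  \<open>angle_field\<close>, whose value is a derivative only on smooth functions and 0
  elsewhere.\<close>

lemma bounded_linear_compose_smooth_functions:
  fixes L :: "'f::euclidean_space \<Rightarrow> real"
  assumes "smooth_atlas M A" and "smooth_map M A UNIV euclid_atlas F" and "bounded_linear L"
  shows "L \<circ> F \<in> smooth_functions M A"
proof -
  have "smooth_on (\<phi> ` U) (\<lambda>x. L (F (inv_into U \<phi> x)))" if "(U, \<phi>) \<in> A" for U \<phi>
  proof -
    have "open (\<phi> ` U)" using assms(1) that by (auto simp: smooth_atlas_def)
    moreover have "smooth_on (\<phi> ` U) (\<lambda>x. F (inv_into U \<phi> x))"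
      using assms(2) that by (fastforce simp: smooth_map_def euclid_atlas_def comp_def)
    ultimately show ?thesis
      using Ck_on_bounded_linear_compose[OF _ assms(3)] by (auto simp: smooth_on_def)
  qed
  moreover have "continuous_on M (\<lambda>x. L (F x))"
    using assms(2) bounded_linear.continuous_on[OF assms(3)] by (auto simp: smooth_map_def)
  ultimately show ?thesis
    by (auto simp: smooth_functions_def smooth_map_def euclid_atlas_def comp_def)
qed

lemma pushforward_nth:
  "pushforward F u a $ j = u a ((\<lambda>y. y $ j) \<circ> F)"
  using bounded_linear_smooth_functions[OF bounded_linear_vec_nth[of j]]
  by (simp add: pushforward_def euclid_tvec_def tangent_map_def)

section \<open>Torus coordinates and the angle curve\<close>

text \<open>Both angles lie within \<pi> of \<open>c\<close>, so they differ by less than the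
  period.\<close>

lemma cis_inj_near:
  assumes "cis x = cis y" and "\<bar>x - c\<bar> < pi" and "\<bar>y - c\<bar> < pi"
  shows "x = y"
proof -
  have "\<i> * complex_of_real x = \<i> * complex_of_real y"
    by (rule exp_complex_eqI) (use assms in \<open>auto simp: cis_conv_exp\<close>)
  then show ?thesis by simp
qed

text \<open>Coordinatewise \<open>Arg\<close> is a choice of angles: \<open>cis_Arg\<close> yields
  \<open>sgn z\<close>, which is \<open>z\<close> itself on the unit circle.\<close>

lemma torus_exp_surj:
  assumes "z \<in> torus"
  obtains \<theta> where "torus_exp \<theta> = z"
proof
  have "cis (Arg (z $ i)) = z $ i" for i
  proof -
    have "cmod (z $ i) = 1" using assms by (simp add: torus_def)
    then show ?thesis using cis_Arg[of "z $ i"] by (force simp: sgn_eq)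
  qed
  then show "torus_exp (\<chi> i. Arg (z $ i)) = z"
    by (simp add: torus_exp_def vec_eq_iff)
qed

lemma open_cube: "open {\<theta> :: real^'m::finite. \<forall>i. \<bar>\<theta> $ i - c $ i\<bar> < r}"
proof -
  have "{\<theta> :: real^'m. \<forall>i. \<bar>\<theta> $ i - c $ i\<bar> < r} = (\<Inter>i. {\<theta>. \<bar>\<theta> $ i - c $ i\<bar> < r})"
    by auto
  also have "open \<dots>"
    by (intro open_INT ballI open_Collect_less continuous_intros) auto
  finally show ?thesis .
qed

text \<open>Near \<open>c\<close> the function factors as the chart expression of \<open>F\<close>
  after the chart expression of \<psi>. Both are differentiable by the definition of
  \<open>smooth_map\<close>, and the chain rule joins them.\<close>

lemma smooth_map_torus_exp_differentiable:
  fixes A :: "('a::{t2_space,second_countable_topology}, 'e::euclidean_space) chart set"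
    and F :: "'a \<Rightarrow> 'f::euclidean_space"
    and \<psi> :: "complex^'m::finite \<Rightarrow> 'a"
  assumes atlas: "smooth_atlas M A"
    and F: "smooth_map M A UNIV euclid_atlas F"
    and \<psi>: "smooth_map torus torus_atlas M A \<psi>"
  shows "(\<lambda>\<theta>. F (\<psi> (torus_exp \<theta>))) differentiable (at c)"
proof -
  \<comment> \<open>The torus chart is centred at \<open>c\<close> itself, so that \<open>c\<close>
    lies in the cube.\<close>
  define Q where "Q = {\<theta> :: real^'m. \<forall>i. \<bar>\<theta> $ i - c $ i\<bar> < pi}"
  define \<kappa> where "\<kappa> = inv_into Q (torus_exp :: real^'m \<Rightarrow> complex^'m)"
  have Q: "open Q" "c \<in> Q"
    unfolding Q_def using open_cube by auto
  have inj: "inj_on torus_exp Q"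
    by (intro inj_onI) (auto simp: Q_def torus_exp_def vec_eq_iff intro: cis_inj_near)
  have chart: "(torus_exp ` Q, \<kappa>) \<in> torus_atlas"
    unfolding torus_atlas_def \<kappa>_def Q_def Let_def by blast
  \<comment> \<open>The chart \<kappa> is itself an \<open>inv_into\<close>; inverting it once more,
    as \<open>smooth_map\<close> does, gives back \<open>torus_exp\<close> on the cube.\<close>
  have inv\<kappa>: "inv_into (torus_exp ` Q) \<kappa> \<theta> = torus_exp \<theta>" if "\<theta> \<in> Q" for \<theta>
  proof (rule inv_into_f_eq)
    show "inj_on \<kappa> (torus_exp ` Q)"
      unfolding \<kappa>_def by (rule inj_on_inv_into) simp
  qed (use that inj in \<open>auto simp: \<kappa>_def\<close>)
  have tor: "torus_exp \<theta> \<in> torus" for \<theta> :: "real^'m"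
    by (simp add: torus_def torus_exp_def)
  define a where "a = \<psi> (torus_exp c)"
  have "a \<in> M" using \<psi> tor by (auto simp: a_def smooth_map_def)
  then obtain U \<phi> where U: "(U, \<phi>) \<in> A" "a \<in> U"
    using atlas by (auto simp: smooth_atlas_def)
  then have opU: "openin (top_of_set M) U" and "homeomorphism U (\<phi> ` U) \<phi> (inv_into U \<phi>)"
    using atlas by (auto simp: smooth_atlas_def)
  then have inv\<phi>: "inv_into U \<phi> (\<phi> x) = x" if "x \<in> U" for x
    using that by (auto simp: homeomorphism_def)
  have "smooth_on (\<kappa> ` (torus_exp ` Q \<inter> \<psi> -` U)) (\<phi> \<circ> \<psi> \<circ> inv_into (torus_exp ` Q) \<kappa>)"
    using \<psi> chart U(1) unfolding smooth_map_def by blast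
  moreover have "c \<in> \<kappa> ` (torus_exp ` Q \<inter> \<psi> -` U)"
    using Q(2) U(2) inj by (intro image_eqI[of _ _ "torus_exp c"]) (auto simp: \<kappa>_def a_def)
  ultimately have 1: "(\<phi> \<circ> \<psi> \<circ> inv_into (torus_exp ` Q) \<kappa>) differentiable (at c)"
    by (rule smooth_on_imp_differentiable)
  have "smooth_on (\<phi> ` U) (F \<circ> inv_into U \<phi>)"
    using F U(1) by (fastforce simp: smooth_map_def euclid_atlas_def)
  then have "(F \<circ> inv_into U \<phi>) differentiable
      (at ((\<phi> \<circ> \<psi> \<circ> inv_into (torus_exp ` Q) \<kappa>) c))"
    using smooth_on_imp_differentiable U(2) Q(2) inv\<kappa> by (auto simp: a_def)
  from differentiable_chain_at[OF 1 this]
  obtain D where D: "((F \<circ> inv_into U \<phi>) \<circ> (\<phi> \<circ> \<psi> \<circ> inv_into (torus_exp ` Q) \<kappa>)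
      has_derivative D) (at c)"
    unfolding differentiable_def ..
  \<comment> \<open>The factorization through \<phi> is valid only where the image lies in
    \<open>U\<close>. Continuity and relative openness of \<open>U\<close> provide this on an open
    set around \<open>c\<close>, which is enough to transfer the derivative.\<close>
  have "continuous_on UNIV (\<lambda>\<theta> :: real^'m. \<psi> (torus_exp \<theta>))"
  proof (rule continuous_on_compose2[of torus \<psi>])
    show "continuous_on torus \<psi>" using \<psi> by (simp add: smooth_map_def)
    show "continuous_on UNIV (torus_exp :: real^'m \<Rightarrow> complex^'m)"
      unfolding torus_exp_def cis_conv_exp
      by (intro continuous_intros)
  qed (use tor in auto)
  moreover obtain O' where O': "open O'" "U = M \<inter> O'"
    using opU by (auto simp: openin_open)
  ultimately have "open ((\<lambda>\<theta>. \<psi> (torus_exp \<theta>)) -` O')"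
    by (simp add: open_vimage continuous_on_eq_continuous_at)
  then have N: "open (Q \<inter> (\<lambda>\<theta>. \<psi> (torus_exp \<theta>)) -` O')" (is "open ?N")
    using Q(1) by auto
  have cN: "c \<in> ?N" using Q U O' by (auto simp: a_def)
  have eq: "((F \<circ> inv_into U \<phi>) \<circ> (\<phi> \<circ> \<psi> \<circ> inv_into (torus_exp ` Q) \<kappa>)) \<theta>
      = F (\<psi> (torus_exp \<theta>))" if "\<theta> \<in> ?N" for \<theta>
  proof -
    have "\<psi> (torus_exp \<theta>) \<in> U" using that O' \<psi> tor by (auto simp: smooth_map_def)
    with that show ?thesis by (simp add: inv\<kappa> inv\<phi>)
  qed
  have "((\<lambda>\<theta>. F (\<psi> (torus_exp \<theta>))) has_derivative D) (at c)"
    by (rule has_derivative_transform_within_open[OF D N cN eq])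
  then show ?thesis by (auto simp: differentiable_def)
qed

text \<open>With angles \<open>c\<close> chosen for the starting point, the addition law of
  \<open>cis\<close> shows that the curve on the torus is \<open>torus_exp\<close> along the line
  through \<open>c\<close> in direction \<open>axis i 1\<close>.\<close>

lemma angle_curve_differentiable:
  fixes A :: "('a::{t2_space,second_countable_topology}, real^'m::finite) chart set"
    and F :: "'a \<Rightarrow> 'f::euclidean_space"
    and \<zeta> :: "'m \<Rightarrow> 'a \<Rightarrow> complex"
  assumes "smooth_atlas M A"
    and "smooth_map M A UNIV euclid_atlas F"
    and "smooth_map torus torus_atlas M A \<psi>"
    and "(\<chi> j. \<zeta> j a) \<in> torus"
  shows "(\<lambda>s. F (\<psi> (\<chi> j. if j = i then cis s * \<zeta> j a else \<zeta> j a))) differentiable (at 0)"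
proof -
  obtain c :: "real^'m" where c: "torus_exp c = (\<chi> j. \<zeta> j a)"
    using torus_exp_surj[OF assms(4)] .
  have "torus_exp (c + s *\<^sub>R axis i 1) = (\<chi> j. if j = i then cis s * \<zeta> j a else \<zeta> j a)" for s
    using c by (auto simp: torus_exp_def vec_eq_iff axis_def add.commute[of "c $ i"]
        simp flip: cis_mult)
  moreover have "((\<lambda>\<theta>. F (\<psi> (torus_exp \<theta>))) \<circ> (\<lambda>s. c + s *\<^sub>R axis i 1)) differentiable (at 0)"
    using smooth_map_torus_exp_differentiable[OF assms(1) assms(2) assms(3)]
    by (intro differentiable_chain_at derivative_intros) auto
  ultimately show ?thesis by (simp add: comp_def)
qed

theorem corollary7:
  fixes M :: "'a::{t2_space,second_countable_topology} set"
    and A :: "('a, real^'m::finite) chart set"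
    and \<Phi> :: "real \<Rightarrow> 'a \<Rightarrow> 'a"
    and v :: "'a vfield"
    and \<mu> :: "'a measure"
    and T :: real
    and \<Omega> :: "'m \<Rightarrow> real"
    and \<zeta> :: "'m \<Rightarrow> 'a \<Rightarrow> complex"
    and w :: "'m \<Rightarrow> 'a vfield"
    and F :: "'a \<Rightarrow> real^'d::finite"
    and G :: "real^'d \<Rightarrow> real^'n::finite"
    and V :: "'m \<Rightarrow> 'a \<Rightarrow> real^'d"
    and V' :: "'m \<Rightarrow> 'a \<Rightarrow> real^'n"
  assumes "smooth_atlas M A" and "compact M" and "connected M" and "orientable M A"
    and "smooth_flow M A \<Phi>" and "smooth_vector_field M A v" and "generates_flow M A v \<Phi>"
    and "prob_space \<mu>" and "sets \<mu> = sets (restrict_space borel M)"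
    and "smooth_positive_density A \<mu>"
    and "\<And>t. measure_preserving \<mu> (\<Phi> t)"
    and "T > 0" and "ergodic \<mu> (\<Phi> T)"
    and "pure_point_system M A \<mu> \<Phi> \<Omega> \<zeta>"
    and "\<And>i a f. w i a f = \<Omega> i * angle_field M A \<zeta> i a f"
    and "smooth_embedding M A F"
    and "\<And>i. V i = pushforward F (w i)"
    and "smooth_on UNIV G"
    and "smooth_embedding M A (G \<circ> F)"
    and "\<And>i. V' i = pushforward (G \<circ> F) (w i)"
  shows "\<forall>i. \<forall>a\<in>M. V' i a = pushforward_along G F (V i) a"
proof (intro allI ballI)
  fix i a assume a: "a \<in> M"
  define e where "e = eigenfunction_map \<zeta>"
  \<comment> \<open>The curve in the definition of \<open>angle_field\<close>, with values in
    \<open>M\<close>.\<close>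
  define c where "c s = inv_into M e (\<chi> j. if j = i then cis s * \<zeta> j a else \<zeta> j a)" for s
  have F: "smooth_map M A UNIV euclid_atlas F" and GF: "smooth_map M A UNIV euclid_atlas (G \<circ> F)"
    using assms(16,19) by (auto simp: smooth_embedding_def)
  have e: "bij_betw e M torus" "smooth_map torus torus_atlas M A (inv_into M e)"
    using assms(14) by (auto simp: pure_point_system_def diffeomorphism_def e_def)
  have ea: "e a = (\<chi> j. \<zeta> j a)"
    by (simp add: e_def eigenfunction_map_def)
  have "(\<chi> j. \<zeta> j a) \<in> torus"
    using e(1) a ea by (metis bij_betwE)
  then have "(\<lambda>s. F (c s)) differentiable (at 0)"
    unfolding c_def by (rule angle_curve_differentiable[OF assms(1) F e(2)])
  then obtain D where D: "((\<lambda>s. F (c s)) has_vector_derivative D) (at 0)"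
    using vector_derivative_works by blast
  have "(\<lambda>j. if j = i then cis 0 * \<zeta> j a else \<zeta> j a) = (\<lambda>j. \<zeta> j a)"
    by auto
  then have "c 0 = inv_into M e (e a)"
    unfolding c_def ea by presburger
  then have c0: "c 0 = a"
    using e(1) a by (simp add: bij_betw_def)
  let ?G' = "frechet_derivative G (at (F a))"
  have G': "(G has_derivative ?G') (at (F (c 0)))"
    using smooth_on_imp_differentiable[OF assms(18)] frechet_derivative_works c0 by blast
  have "linear ?G'" using G' has_derivative_linear by blast
  \<comment> \<open>The chain rule gives \<open>?G' (s *\<^sub>R D)\<close> as the derivative
    applied to \<open>s\<close>; linearity turns this into \<open>s\<close> times the velocity
    \<open>?G' D\<close>.\<close>
  with has_derivative_compose[OF D[unfolded has_vector_derivative_def] G']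
  have GD: "((\<lambda>s. G (F (c s))) has_vector_derivative ?G' D) (at 0)"
    by (simp add: has_vector_derivative_def linear_scale)
  have w: "w i a f = \<Omega> i * deriv (\<lambda>s. f (c s)) 0" if "f \<in> smooth_functions M A" for f
    using that assms(15) by (simp add: angle_field_def c_def e_def)
  \<comment> \<open>The target dimension is left open, since the fact is used both for
    \<open>F\<close>, with velocity \<open>D\<close>, and for \<open>G \<circ> F\<close>, with
    velocity \<open>?G' D\<close>.\<close>
  have push: "pushforward H (w i) a = \<Omega> i *\<^sub>R X"
    if H: "smooth_map M A UNIV euclid_atlas H"
      and X: "((\<lambda>s. H (c s)) has_vector_derivative X) (at 0)"
    for H :: "'a \<Rightarrow> real^'k::finite" and X
  proof -
    have "((\<lambda>s. H (c s) $ j) has_real_derivative X $ j) (at 0)" for j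
      using bounded_linear.has_vector_derivative[OF bounded_linear_vec_nth X]
      by (simp add: has_real_derivative_iff_has_vector_derivative)
    then have "deriv (\<lambda>s. H (c s) $ j) 0 = X $ j" for j
      by (rule DERIV_imp_deriv)
    then show ?thesis
      using w bounded_linear_compose_smooth_functions[OF assms(1) H bounded_linear_vec_nth]
      by (simp add: vec_eq_iff pushforward_nth comp_def)
  qed
  have "V' i a = \<Omega> i *\<^sub>R ?G' D"
    using push[OF GF] GD assms(20) by simp
  \<comment> \<open>The factor \<Omega> at \<open>i\<close> passes through the derivative of
    \<open>G\<close>, which turns the velocity \<open>D\<close> into the vector
    \<open>V i a\<close>.\<close>
  also have "\<dots> = ?G' (\<Omega> i *\<^sub>R D)"
    using \<open>linear ?G'\<close> by (simp add: linear_scale)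
  also have "\<Omega> i *\<^sub>R D = V i a"
    using push[OF F D] assms(17) by simp
  finally show "V' i a = pushforward_along G F (V i) a"
    by (simp add: pushforward_along_def)
qed

end
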